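(* Let $P$, $X$, $Y$ be metric spaces, $P\times X$ being equipped with the max distance, let $C\subset Y$ be a nonempty closed proper subset, let $F:P\times X\rightrightarrows Y$ be a set-valued mapping with $F(p,x)\neq\varnothing$ for all $(p,x)\in P\times X$, and let $\vartheta:P\times X\to\mathbb R$ be a function. For $p\in P$ let $S(p)=\{x\in X: F(p,x)\subseteq C\}$, $\mathrm{val}(p)=\inf_{x\in S(p)}\vartheta(p,x)$ and $\mathrm{Argmin}(p)=\{x\in S(p):\vartheta(p,x)\le\mathrm{val}(p)\}$, and let $\varphi_F(p,x)=\sup_{y\in F(p,x)}\mathrm{dist}(y,C)$. Let $\bar p\in P$ and $\bar x\in\mathrm{Argmin}(\bar p)$. Suppose that: (i) $(X,d)$ is metrically complete; (ii) $F$ is locally Lipschitz near $\bar p$ with respect to $p$, uniformly in $x\in X$; (iii) there exists $\delta>0$ such that, for every $p\in B(\bar p,\delta)$, the mapping $F(p,\cdot):X\rightrightarrows Y$ is lower semicontinuous on $X$; (iv) $\min\{\overline{|\nabla_x\varphi_F|}{}^{>}(\bar p,\bar x),\ \tau_{\bar p}\}>0$; (v) $\vartheta$ is Lipschitz continuous on $P\times X$. Then $\mathrm{val}:P\to\mathbb R\cup\{\pm\infty\}$ is calm at $\bar p$ and $$\mathrm{clm}\,\mathrm{val}(\bar p)\le\mathrm{Lip}\,\vartheta(P,X)\cdot\max\left\{1,\ \frac{\mathrm{Lip_p}\,F(\bar p,X)}{\min\{\overline{|\nabla_x\varphi_F|}{}^{>}(\bar p,\bar x),\ \tau_{\bar 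p}\}}\right\}.$$
   Context: All metrics are denoted $d$. $B(x,r)$ is the closed ball of center $x$ and radius $r$; $\mathrm{dist}(x,A)=\inf_{a\in A}d(x,a)$. For subsets $A,B$ of a metric space, $\mathrm{exc}(A,B)=\sup_{a\in A}\mathrm{dist}(a,B)$ and $\mathrm{haus}(A,B)=\max\{\mathrm{exc}(A,B),\mathrm{exc}(B,A)\}$. A set-valued mapping $\Phi:X\rightrightarrows Y$ between metric spaces is lower semicontinuous (l.s.c.) at $\bar x$ if for every open $O\subseteq Y$ with $\Phi(\bar x)\cap O\neq\varnothing$ there is a neighbourhood $U$ of $\bar x$ with $\Phi(x)\cap O\ne\varnothing$ for all $x\in U$. $F$ is locally Lipschitz near $\bar p$ with respect to $p$, uniformly in $x\in X$, if there are $\ell,\delta>0$ such that $\sup_{x\in X}\mathrm{haus}(F(p_1,x),F(p_2,x))\le\ell d(p_1,p_2)$ for all $p_1,p_2\in B(\bar p,\delta)$; $\mathrm{Lip_p}\,F(\bar p,X)$ is the infimum of all $\ell>0$ for which such a $\delta>0$ exists. $\mathrm{Lip}\,\vartheta(P,X)$ is the infimum of all $\ell>0$ such that $|\vartheta(p_1,x_1)-\vartheta(p_2,x_2)|\le\ell\max\{d(p_1,p_2),d(x_1,x_2)\}$ for all $(p_1,x_1),(p_2,x_2)\in P\times X$. A function $g:P\to\mathbb R\cup\{\pm\infty\}$ is calm at a point $\bar p$ with $g(\bar p)\in\mathbb R$ if there are $\delta,\ell>0$ such that $|g(p)-g(\bar p)|\le\ell d(p,\bar p)$ for all $p\in B(\bar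 p,\delta)$; $\mathrm{clm}\,g(\bar p)$ is the infimum of all $\ell>0$ for which such a $\delta>0$ exists. The strong slope of $\psi:X\to\mathbb R\cup\{\pm\infty\}$ at a point $x$ with $\psi(x)\in\mathbb R$ is $|\nabla\psi|(x)=0$ if $x$ is a local minimizer of $\psi$, and $|\nabla\psi|(x)=\limsup_{z\to x}\frac{\psi(x)-\psi(z)}{d(z,x)}$ otherwise. Set $$\overline{|\nabla_x\varphi_F|}{}^{>}(\bar p,\bar x)=\lim_{\epsilon\to0^+}\inf\{|\nabla\varphi_F(p,\cdot)|(x):(p,x)\in B(\bar p,\epsilon)\times B(\bar x,\epsilon),\ \varphi_F(\bar p,\bar x)<\varphi_F(p,x)<\varphi_F(\bar p,\bar x)+\epsilon\},$$ $$\tau_{\bar p}=\inf\{|\nabla\varphi_F(\bar p,\cdot)|(x): x\in X\setminus S(\bar p)\},$$ the last infimum being over those $x$ at which the slope is defined, i.e. $\varphi_F(\bar p,x)<+\infty$. Conventions: $\inf\varnothing=+\infty$; a finite number divided by $+\infty$ is $0$. *)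

theory Defs
  imports "HOL-Analysis.Analysis"
begin

text \<open>Metric spaces are types of class \<open>metric_space\<close>; quantities that may be infinite live in
  \<^typ>\<open>ereal\<close>.  Functions on \<open>P \<times> X\<close> are curried, because the product type of the library carries
  the Euclidean product distance and not the max distance; the latter is written out where needed.\<close>

text \<open>The library function \<^const>\<open>infdist\<close> is the infimum of the distances except for the empty set,
  where it is \<open>0\<close> and not \<open>\<infinity>\<close>.  It is only meant to be used with nonempty sets below.\<close>

definition exc :: "'a::metric_space set \<Rightarrow> 'a set \<Rightarrow> ereal" where
  "exc A B = (SUP a\<in>A. ereal (infdist a B))"

definition haus :: "'a::metric_space set \<Rightarrow> 'a set \<Rightarrow> ereal" where
  "haus A B = max (exc A B) (exc B A)"

definition lsc_at :: "('a::topological_space \<Rightarrow> 'b::topological_space set) \<Rightarrow> 'a \<Rightarrow> bool" where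
  "lsc_at \<Phi> a \<longleftrightarrow>
    (\<forall>O'. open O' \<longrightarrow> \<Phi> a \<inter> O' \<noteq> {} \<longrightarrow> (\<forall>\<^sub>F x in nhds a. \<Phi> x \<inter> O' \<noteq> {}))"

definition lip_p_rank ::
  "('p::metric_space \<Rightarrow> 'x \<Rightarrow> 'y::metric_space set) \<Rightarrow> 'p \<Rightarrow> real \<Rightarrow> real \<Rightarrow> bool" where
  "lip_p_rank F pb l \<delta> \<longleftrightarrow>
    (\<forall>p1\<in>cball pb \<delta>. \<forall>p2\<in>cball pb \<delta>.
      (SUP x. haus (F p1 x) (F p2 x)) \<le> ereal (l * dist p1 p2))"

definition locally_lipschitz_p ::
  "('p::metric_space \<Rightarrow> 'x \<Rightarrow> 'y::metric_space set) \<Rightarrow> 'p \<Rightarrow> bool" where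
  "locally_lipschitz_p F pb \<longleftrightarrow> (\<exists>l>0. \<exists>\<delta>>0. lip_p_rank F pb l \<delta>)"

definition Lip_p :: "('p::metric_space \<Rightarrow> 'x \<Rightarrow> 'y::metric_space set) \<Rightarrow> 'p \<Rightarrow> ereal" where
  "Lip_p F pb = Inf (ereal ` {l. l > 0 \<and> (\<exists>\<delta>>0. lip_p_rank F pb l \<delta>)})"

definition lip_rank :: "('p::metric_space \<Rightarrow> 'x::metric_space \<Rightarrow> real) \<Rightarrow> real \<Rightarrow> bool" where
  "lip_rank \<theta> l \<longleftrightarrow>
    (\<forall>p1 x1 p2 x2. \<bar>\<theta> p1 x1 - \<theta> p2 x2\<bar> \<le> l * max (dist p1 p2) (dist x1 x2))"

definition lipschitz_fun :: "('p::metric_space \<Rightarrow> 'x::metric_space \<Rightarrow> real) \<Rightarrow> bool" where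
  "lipschitz_fun \<theta> \<longleftrightarrow> (\<exists>l>0. lip_rank \<theta> l)"

definition Lip :: "('p::metric_space \<Rightarrow> 'x::metric_space \<Rightarrow> real) \<Rightarrow> ereal" where
  "Lip \<theta> = Inf (ereal ` {l. l > 0 \<and> lip_rank \<theta> l})"

definition calm_rank :: "('p::metric_space \<Rightarrow> ereal) \<Rightarrow> 'p \<Rightarrow> real \<Rightarrow> real \<Rightarrow> bool" where
  "calm_rank g pb l \<delta> \<longleftrightarrow> (\<forall>p\<in>cball pb \<delta>. \<bar>g p - g pb\<bar> \<le> ereal (l * dist p pb))"

definition calm_at :: "('p::metric_space \<Rightarrow> ereal) \<Rightarrow> 'p \<Rightarrow> bool" where
  "calm_at g pb \<longleftrightarrow> \<bar>g pb\<bar> \<noteq> \<infinity> \<and> (\<exists>l>0. \<exists>\<delta>>0. calm_rank g pb l \<delta>)"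

definition clm :: "('p::metric_space \<Rightarrow> ereal) \<Rightarrow> 'p \<Rightarrow> ereal" where
  "clm g pb = Inf (ereal ` {l. l > 0 \<and> (\<exists>\<delta>>0. calm_rank g pb l \<delta>)})"

text \<open>Meaningful only at points where \<open>\<psi>\<close> is finite.  At an isolated point every function has a
  local minimum, so the limit superior is never taken along the trivial filter.\<close>

definition strong_slope :: "('x::metric_space \<Rightarrow> ereal) \<Rightarrow> 'x \<Rightarrow> ereal" where
  "strong_slope \<psi> x =
    (if \<forall>\<^sub>F z in nhds x. \<psi> x \<le> \<psi> z then 0
     else Limsup (at x) (\<lambda>z. (\<psi> x - \<psi> z) / ereal (dist z x)))"

definition feasible :: "('p \<Rightarrow> 'x \<Rightarrow> 'y set) \<Rightarrow> 'y set \<Rightarrow> 'p \<Rightarrow> 'x set" where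
  "feasible F C p = {x. F p x \<subseteq> C}"

definition opt_val :: "('p \<Rightarrow> 'x \<Rightarrow> 'y set) \<Rightarrow> 'y set \<Rightarrow> ('p \<Rightarrow> 'x \<Rightarrow> real) \<Rightarrow> 'p \<Rightarrow> ereal" where
  "opt_val F C \<theta> p = (INF x\<in>feasible F C p. ereal (\<theta> p x))"

definition Argmin :: "('p \<Rightarrow> 'x \<Rightarrow> 'y set) \<Rightarrow> 'y set \<Rightarrow> ('p \<Rightarrow> 'x \<Rightarrow> real) \<Rightarrow> 'p \<Rightarrow> 'x set" where
  "Argmin F C \<theta> p = {x \<in> feasible F C p. ereal (\<theta> p x) \<le> opt_val F C \<theta> p}"

definition merit :: "('p \<Rightarrow> 'x \<Rightarrow> 'y::metric_space set) \<Rightarrow> 'y set \<Rightarrow> 'p \<Rightarrow> 'x \<Rightarrow> ereal" where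
  "merit F C p x = (SUP y\<in>F p x. ereal (infdist y C))"

definition partial_slope_inf ::
  "('p::metric_space \<Rightarrow> 'x::metric_space \<Rightarrow> ereal) \<Rightarrow> 'p \<Rightarrow> 'x \<Rightarrow> real \<Rightarrow> ereal" where
  "partial_slope_inf \<phi> pb xb \<epsilon> =
    (INF (p, x) \<in> {(p, x). p \<in> cball pb \<epsilon> \<and> x \<in> cball xb \<epsilon> \<and>
                          \<phi> pb xb < \<phi> p x \<and> \<phi> p x < \<phi> pb xb + ereal \<epsilon>}.
       strong_slope (\<phi> p) x)"

definition strict_outer_partial_slope ::
  "('p::metric_space \<Rightarrow> 'x::metric_space \<Rightarrow> ereal) \<Rightarrow> 'p \<Rightarrow> 'x \<Rightarrow> ereal" where
  "strict_outer_partial_slope \<phi> pb xb = Lim (at_right 0) (partial_slope_inf \<phi> pb xb)"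

text \<open>The limit above always exists.\<close>

lemma partial_slope_inf_tendsto:
  "(partial_slope_inf \<phi> pb xb \<longlongrightarrow> strict_outer_partial_slope \<phi> pb xb) (at_right 0)"
proof -
  let ?g = "partial_slope_inf \<phi> pb xb"
  let ?s = "SUP \<epsilon>\<in>{0<..}. ?g \<epsilon>"
  have anti: "?g \<epsilon>' \<le> ?g \<epsilon>" if "\<epsilon> \<le> \<epsilon>'" for \<epsilon> \<epsilon>'
  proof -
    have "\<phi> pb xb + ereal \<epsilon> \<le> \<phi> pb xb + ereal \<epsilon>'"
      using that by (intro add_left_mono) simp
    then show ?thesis
      unfolding partial_slope_inf_def using that
      by (intro INF_superset_mono) (auto intro: order_trans less_le_trans)
  qed
  have "(?g \<longlongrightarrow> ?s) (at_right 0)"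
  proof (rule order_tendstoI)
    fix a assume "a < ?s"
    then obtain e where e: "e > 0" "a < ?g e"
      by (auto simp: less_SUP_iff)
    have "\<forall>\<^sub>F \<epsilon> in at_right (0::real). \<epsilon> < e"
      using e(1) by (rule order_tendstoD(2)[OF tendsto_ident_at])
    then show "\<forall>\<^sub>F \<epsilon> in at_right 0. a < ?g \<epsilon>"
      by eventually_elim (use e(2) anti in \<open>meson less_imp_le less_le_trans\<close>)
  next
    fix a assume "?s < a"
    have "\<forall>\<^sub>F \<epsilon> in at_right (0::real). \<epsilon> > 0"
      by (rule eventually_at_right_less)
    then show "\<forall>\<^sub>F \<epsilon> in at_right 0. ?g \<epsilon> < a"
      by eventually_elim (use \<open>?s < a\<close> in \<open>auto intro: le_less_trans[OF SUP_upper]\<close>)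
  qed
  then show ?thesis
    unfolding strict_outer_partial_slope_def
    by (metis tendsto_Lim trivial_limit_at_right_real)
qed

definition slope_outside ::
  "('p \<Rightarrow> 'x::metric_space \<Rightarrow> 'y::metric_space set) \<Rightarrow> 'y set \<Rightarrow> 'p \<Rightarrow> ereal" where
  "slope_outside F C pb =
    (INF x \<in> {x. x \<notin> feasible F C pb \<and> merit F C pb x < \<infinity>}. strong_slope (merit F C pb) x)"

end

theory Submission
  imports Defs
begin

text \<open>A point where Ekeland's variational principle with constant \<open>c\<close> applies has strong slope at
  most \<open>c\<close>; hence a slope bounded below by \<open>c\<close> where the merit function is positive forces
  the distance to the feasible set to be at most the merit function divided by \<open>c\<close>.
  At a point feasible for one parameter, the merit function for another parameter is at most
  \<open>l * dist p pb\<close>.  The local error bound, started from \<open>xb\<close> with parameter \<open>p\<close>, gives the upper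
  estimate of the value function; the global error bound for the parameter \<open>pb\<close>, started from an
  arbitrary point feasible for \<open>p\<close>, gives the lower one.\<close>

section \<open>Ekeland's variational principle\<close>

text \<open>Near-minimizers are chosen successively in the nested sets \<open>S (X n)\<close>, whose
  sizes shrink geometrically. Completeness gives a limit \<open>u\<close>, lower semicontinuity puts
  \<open>u\<close> into every \<open>S (X n)\<close>, and then \<open>S u\<close> contains only
  \<open>u\<close>, which is the strict inequality.\<close>

lemma ekeland:
  fixes f :: "'a::metric_space \<Rightarrow> ereal"
  assumes compl: "complete (UNIV :: 'a set)"
    and nonneg: "\<And>x. 0 \<le> f x"
    and lsc: "\<And>x a. a < f x \<Longrightarrow> \<forall>\<^sub>F z in nhds x. a < f z"
    and fin: "f x0 < \<infinity>" and c: "c > 0"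
  obtains u where "f u + ereal (c * dist u x0) \<le> f x0"
    and "\<And>z. z \<noteq> u \<Longrightarrow> f u < f z + ereal (c * dist z u)"
proof -
  \<comment> \<open>Ekeland's preorder: \<open>z\<close> lies below \<open>x\<close> if the drop
    from \<open>f x\<close> to \<open>f z\<close> pays for the distance at price
    \<open>c\<close>.\<close>
  define S where "S x = {z. f z + ereal (c * dist z x) \<le> f x}" for x
  have self: "x \<in> S x" for x
    by (simp add: S_def)
  have S_le: "f z \<le> f x" if "z \<in> S x" for z x
  proof -
    have "f z + 0 \<le> f z + ereal (c * dist z x)"
      using c by (intro add_left_mono) simp
    with that show ?thesis
      by (simp add: S_def)
  qed
  have trans: "w \<in> S x" if w: "w \<in> S z" and z: "z \<in> S x" for w z x
  proof -
    have "c * dist w x \<le> c * dist w z + c * dist z x"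
      using c dist_triangle[of w x z] by (simp flip: distrib_left)
    then have "f w + ereal (c * dist w x) \<le> f w + ereal (c * dist w z) + ereal (c * dist z x)"
      by (simp add: add.assoc add_left_mono)
    also have "\<dots> \<le> f z + ereal (c * dist z x)"
      using w by (intro add_right_mono) (simp add: S_def)
    also have "\<dots> \<le> f x"
      using z by (simp add: S_def)
    finally show ?thesis
      by (simp add: S_def)
  qed
  define I where "I x = (INF z\<in>S x. f z)" for x
  have I_nonneg: "0 \<le> I x" for x
    unfolding I_def by (intro INF_greatest nonneg)
  have I_le: "I x \<le> f x" for x
    unfolding I_def by (intro INF_lower self)
  \<comment> \<open>Since \<open>f x\<close> is finite, \<open>I x\<close> is a real number, so
    adding the power really increases it and a near-minimizer exists.\<close>
  have pick: "\<exists>z. z \<in> S x \<and> f z < I x + ereal ((1/2)^n)" if "f x < \<infinity>" for x n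
  proof -
    have "I x < I x + ereal ((1/2)^n)"
      using I_nonneg[of x] I_le[of x] that by (cases "I x") auto
    then show ?thesis
      unfolding I_def by (metis INF_less_iff)
  qed
  obtain X where X0: "X 0 = x0" and Xfin: "\<And>n. f (X n) < \<infinity>"
    and XS: "\<And>n. X (Suc n) \<in> S (X n)"
    and XI: "\<And>n. f (X (Suc n)) < I (X n) + ereal ((1/2)^n)"
  proof -
    have "\<exists>X. \<forall>n. (f (X n) < \<infinity> \<and> (n = 0 \<longrightarrow> X n = x0)) \<and>
        (X (Suc n) \<in> S (X n) \<and> f (X (Suc n)) < I (X n) + ereal ((1/2)^n))"
    proof (rule dependent_nat_choice)
      show "\<exists>x. f x < \<infinity> \<and> ((0::nat) = 0 \<longrightarrow> x = x0)"
        using fin by auto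
      fix x and n :: nat
      assume "f x < \<infinity> \<and> (n = 0 \<longrightarrow> x = x0)"
      then obtain z where "z \<in> S x" "f z < I x + ereal ((1/2)^n)" "f z < \<infinity>"
        using pick[of x n] S_le[of _ x] by (metis le_less_trans)
      then show "\<exists>y. (f y < \<infinity> \<and> (Suc n = 0 \<longrightarrow> y = x0)) \<and> y \<in> S x \<and> f y < I x + ereal ((1/2)^n)"
        by auto
    qed
    then show thesis
      using that by blast
  qed
  have chain: "X m \<in> S (X n)" if "n \<le> m" for m n
    using that by (induction m rule: dec_induct) (auto intro: self trans XS)
  \<comment> \<open>By transitivity \<open>w\<close> also competes in the infimum
    \<open>I (X n)\<close>, so \<open>f w\<close> lies less than \<open>(1/2)^n\<close> below
    \<open>f (X (Suc n))\<close>; this drop pays for the distance. The index is shifted because the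
    starting point \<open>X 0\<close> is not a near-minimizer.\<close>
  have small: "dist w (X (Suc n)) < (1/2)^n / c" if w: "w \<in> S (X (Suc n))" for w n
  proof -
    have "I (X n) \<le> f w"
      unfolding I_def using trans[OF w XS] by (rule INF_lower)
    then have *: "f (X (Suc n)) < f w + ereal ((1/2)^n)"
      using XI[of n] by (meson add_right_mono less_le_trans)
    have "f w + ereal (c * dist w (X (Suc n))) \<le> f (X (Suc n))"
      using w by (simp add: S_def)
    then have "f w + ereal (c * dist w (X (Suc n))) < f w + ereal ((1/2)^n)"
      using * by (rule le_less_trans)
    then have "c * dist w (X (Suc n)) < (1/2)^n"
      by (cases "f w") auto
    then show ?thesis
      using c by (simp add: field_simps)
  qed
  have rate: "(\<lambda>n. (1/2)^n / c) \<longlonglongrightarrow> 0"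
    by (intro tendsto_divide_0 tendsto_divide_zero LIMSEQ_power_zero) auto
  have "Cauchy (\<lambda>n. X (Suc n))"
  proof (rule metric_CauchyI)
    fix e :: real assume "e > 0"
    then have "\<forall>\<^sub>F n in sequentially. (1/2)^n / c < e / 2"
      by (intro order_tendstoD(2)[OF rate]) simp
    then obtain N where N: "(1/2)^N / c < e / 2"
      by (auto simp: eventually_sequentially)
    have "dist (X (Suc m)) (X (Suc n)) < e" if "m \<ge> N" "n \<ge> N" for m n
    proof -
      have "dist (X (Suc m)) (X (Suc N)) < e / 2" "dist (X (Suc n)) (X (Suc N)) < e / 2"
        using small[OF chain, of N] that N by (meson Suc_le_mono less_trans)+
      then show ?thesis
        by (rule dist_triangle_half_l)
    qed
    then show "\<exists>M. \<forall>m\<ge>M. \<forall>n\<ge>M. dist (X (Suc m)) (X (Suc n)) < e"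
      by blast
  qed
  then obtain u where u: "(\<lambda>n. X (Suc n)) \<longlonglongrightarrow> u"
    using compl by (auto simp: complete_def)
  then have u': "X \<longlonglongrightarrow> u"
    by (simp add: filterlim_sequentially_Suc)
  have uS: "u \<in> S (X n)" for n
  proof (rule ccontr)
    assume "u \<notin> S (X n)"
    moreover obtain r where r: "f (X n) = ereal r"
      using Xfin[of n] nonneg[of "X n"] by (cases "f (X n)") auto
    ultimately have "ereal (r - c * dist u (X n)) < f u"
      by (cases "f u") (auto simp: S_def)
    \<comment> \<open>A level strictly in between turns lower semicontinuity at \<open>u\<close>
      into a bound along the sequence; in the limit it contradicts the choice of
      \<open>a\<close>.\<close>
    then obtain a where a: "r - c * dist u (X n) < a" "ereal a < f u"
      using ereal_dense2 by force
    have "\<forall>\<^sub>F m in sequentially. ereal a < f (X m)"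
      using lsc[OF a(2)] u' by (auto simp: filterlim_iff)
    moreover have "\<forall>\<^sub>F m in sequentially. n \<le> m"
      by (rule eventually_ge_at_top)
    ultimately have "\<forall>\<^sub>F m in sequentially. a \<le> r - c * dist (X m) (X n)"
    proof eventually_elim
      case (elim m)
      then show ?case
        using chain[of n m] by (cases "f (X m)") (auto simp: S_def r)
    qed
    moreover have "(\<lambda>m. r - c * dist (X m) (X n)) \<longlonglongrightarrow> r - c * dist u (X n)"
      using u' by (intro tendsto_intros)
    ultimately have "a \<le> r - c * dist u (X n)"
      by (intro tendsto_lowerbound) auto
    with a(1) show False
      by simp
  qed
  \<comment> \<open>Such a \<open>z\<close> lies in every \<open>S (X (Suc n))\<close>, so the
    sequence converges to \<open>z\<close> as well.\<close>
  have uniq: "z = u" if z: "z \<in> S u" for z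
  proof -
    have "dist z (X (Suc n)) \<le> (1/2)^n / c" for n
      using small[OF trans[OF z uS]] by (simp add: less_imp_le)
    then have "(\<lambda>n. X (Suc n)) \<longlonglongrightarrow> z"
      using c by (intro metric_tendsto_imp_tendsto[OF rate]) (auto simp: dist_commute)
    then show ?thesis
      using u LIMSEQ_unique by blast
  qed
  show thesis
  proof (rule that)
    show "f u + ereal (c * dist u x0) \<le> f x0"
      using uS[of 0] by (simp add: S_def X0)
    show "f u < f z + ereal (c * dist z u)" if "z \<noteq> u" for z
      using uniq[of z] that unfolding S_def mem_Collect_eq not_le[symmetric] by blast
  qed
qed

section \<open>From slopes to error bounds\<close>

text \<open>All difference quotients at \<open>u\<close> are at most \<open>c\<close>, hence so is
  their limit superior; \<open>c \<ge> 0\<close> covers the case of a local minimizer, where the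
  slope is 0.\<close>

lemma strong_slope_le:
  fixes f :: "'a::metric_space \<Rightarrow> ereal"
  assumes "0 \<le> f u" "f u < \<infinity>" "c \<ge> 0"
    and le: "\<And>z. z \<noteq> u \<Longrightarrow> f u \<le> f z + ereal (c * dist z u)"
  shows "strong_slope f u \<le> ereal c"
proof -
  have "(f u - f z) / ereal (dist z u) \<le> ereal c" if "z \<noteq> u" for z
  proof -
    have "f u - f z \<le> ereal (c * dist z u)"
      using le[OF that] assms(1,2) by (cases "f u"; cases "f z") auto
    then show ?thesis
      using that by (intro ereal_divide_le_pos[THEN iffD2]) (auto simp: mult.commute)
  qed
  then have "Limsup (at u) (\<lambda>z. (f u - f z) / ereal (dist z u)) \<le> ereal c"
    by (intro Limsup_bounded) (auto simp: eventually_at_filter)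
  then show ?thesis
    using assms(3) by (auto simp: strong_slope_def)
qed

text \<open>The Ekeland point has slope at most \<open>c\<close>, so a positive value there would
  violate \<open>slope\<close>. The slope is bounded below only where that point can lie, in the
  ball of radius \<open>t / c\<close> and at levels up to \<open>t\<close>, so that one lemma yields
  local and global bounds.\<close>

lemma error_bound:
  fixes f :: "'a::metric_space \<Rightarrow> ereal"
  assumes compl: "complete (UNIV :: 'a set)"
    and nonneg: "\<And>x. 0 \<le> f x"
    and lsc: "\<And>x a. a < f x \<Longrightarrow> \<forall>\<^sub>F z in nhds x. a < f z"
    and t: "f x0 \<le> ereal t" and c: "c > 0"
    and slope: "\<And>x. dist x x0 \<le> t / c \<Longrightarrow> 0 < f x \<Longrightarrow> f x \<le> ereal t \<Longrightarrow> ereal c < strong_slope f x"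
  obtains u where "f u = 0" "dist u x0 \<le> t / c"
proof -
  have "f x0 < \<infinity>"
    using t by auto
  then obtain u where u: "f u + ereal (c * dist u x0) \<le> f x0"
    and min: "\<And>z. z \<noteq> u \<Longrightarrow> f u < f z + ereal (c * dist z u)"
    using ekeland[OF compl nonneg lsc _ c] by blast
  obtain r where r: "f u = ereal r" "0 \<le> r" "r + c * dist u x0 \<le> t"
    using u t nonneg[of u] by (cases "f u"; cases "f x0") auto
  have "c * dist u x0 \<ge> 0"
    using c by simp
  with r have "c * dist u x0 \<le> t" "r \<le> t"
    by linarith+
  then have d: "dist u x0 \<le> t / c"
    using c by (simp add: field_simps)
  have "strong_slope f u \<le> ereal c"
    using r c min by (intro strong_slope_le) (auto intro: less_imp_le)
  then have "f u = 0"
    using slope[OF d] r \<open>r \<le> t\<close> by (cases "r = 0") auto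
  with d show thesis
    using that by blast
qed

section \<open>Properties of the merit function\<close>

lemma merit_nonneg:
  assumes "F p x \<noteq> {}"
  shows "0 \<le> merit F C p x"
proof -
  obtain y where "y \<in> F p x"
    using assms by blast
  then show ?thesis
    unfolding merit_def by (intro SUP_upper2[of y]) (auto simp: infdist_nonneg)
qed

text \<open>Closedness of \<open>C\<close> turns distance zero into membership; nonemptiness of
  \<open>F p x\<close> excludes the empty supremum, which is \<open>-\<infinity>\<close>.\<close>

lemma merit_eq_0_iff:
  assumes "closed C" "C \<noteq> {}" "F p x \<noteq> {}"
  shows "merit F C p x = 0 \<longleftrightarrow> x \<in> feasible F C p"
proof -
  have "merit F C p x \<le> 0 \<longleftrightarrow> (\<forall>y\<in>F p x. infdist y C = 0)"
    by (simp add: merit_def SUP_le_iff antisym_conv infdist_nonneg)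
  also have "\<dots> \<longleftrightarrow> x \<in> feasible F C p"
    using in_closed_iff_infdist_zero[OF assms(1,2)] by (auto simp: feasible_def)
  finally have "merit F C p x \<le> 0 \<longleftrightarrow> x \<in> feasible F C p" .
  then show ?thesis
    using merit_nonneg[of F p x C, OF assms(3)] by auto
qed

text \<open>The points at distance more than \<open>a\<close> from \<open>C\<close> form an open
  set, and a set-valued map that is lower semicontinuous keeps meeting it.\<close>

lemma merit_lsc:
  assumes "lsc_at (F p) x" "a < merit F C p x"
  shows "\<forall>\<^sub>F z in nhds x. a < merit F C p z"
proof -
  let ?O = "{y. a < ereal (infdist y C)}"
  have "open ?O"
    by (intro open_Collect_less continuous_intros)
  moreover have "F p x \<inter> ?O \<noteq> {}"
    using assms(2) by (auto simp: merit_def less_SUP_iff)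
  ultimately have "\<forall>\<^sub>F z in nhds x. F p z \<inter> ?O \<noteq> {}"
    using assms(1) by (auto simp: lsc_at_def)
  then show ?thesis
    by eventually_elim (auto simp: merit_def less_SUP_iff)
qed

text \<open>As \<open>F p1 x\<close> lies in \<open>C\<close>, distances to \<open>C\<close> are at
  most distances to \<open>F p1 x\<close>, so the merit at \<open>p2\<close> is at most an excess.
  Nonemptiness of \<open>F p1 x\<close> matters because \<open>infdist\<close> to the empty set is
  0.\<close>

lemma merit_le_lip_p_rank:
  assumes rank: "lip_p_rank F pb l \<delta>" and p: "p1 \<in> cball pb \<delta>" "p2 \<in> cball pb \<delta>"
    and ne: "F p1 x \<noteq> {}" and x: "x \<in> feasible F C p1"
  shows "merit F C p2 x \<le> ereal (l * dist p1 p2)"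
proof -
  have "exc (F p2 x) (F p1 x) \<le> haus (F p1 x) (F p2 x)"
    by (simp add: haus_def)
  also have "\<dots> \<le> (SUP x. haus (F p1 x) (F p2 x))"
    by (rule SUP_upper) simp
  also have "\<dots> \<le> ereal (l * dist p1 p2)"
    using rank p by (auto simp: lip_p_rank_def)
  finally have "exc (F p2 x) (F p1 x) \<le> ereal (l * dist p1 p2)" .
  moreover have "infdist y C \<le> infdist y (F p1 x)" for y
    using x ne by (intro infdist_mono) (auto simp: feasible_def)
  ultimately show ?thesis
    unfolding merit_def exc_def SUP_le_iff by (auto intro: order_trans)
qed

text \<open>Replaces the limit defining the outer slope by a single radius on which the strict bound
  holds.\<close>

lemma strict_outer_partial_slope_gt:
  assumes "a < strict_outer_partial_slope \<phi> pb xb"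
  obtains \<epsilon> where "\<epsilon> > 0"
    and "\<And>p x. p \<in> cball pb \<epsilon> \<Longrightarrow> x \<in> cball xb \<epsilon> \<Longrightarrow> \<phi> pb xb < \<phi> p x \<Longrightarrow>
      \<phi> p x < \<phi> pb xb + ereal \<epsilon> \<Longrightarrow> a < strong_slope (\<phi> p) x"
proof -
  have "\<forall>\<^sub>F \<epsilon> in at_right 0. a < partial_slope_inf \<phi> pb xb \<epsilon> \<and> 0 < \<epsilon>"
    using order_tendstoD(1)[OF partial_slope_inf_tendsto assms] eventually_at_right_less
    by (rule eventually_conj)
  then obtain \<epsilon> where \<epsilon>: "a < partial_slope_inf \<phi> pb xb \<epsilon>" "0 < \<epsilon>"
    using eventually_happens by fastforce
  show thesis
  proof (rule that)
    fix p x
    assume "p \<in> cball pb \<epsilon>" "x \<in> cball xb \<epsilon>" "\<phi> pb xb < \<phi> p x" "\<phi> p x < \<phi> pb xb + ereal \<epsilon>"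
    then have "partial_slope_inf \<phi> pb xb \<epsilon> \<le> strong_slope (\<phi> p) x"
      unfolding partial_slope_inf_def by (intro INF_lower2[of "(p, x)"]) auto
    with \<epsilon>(1) show "a < strong_slope (\<phi> p) x"
      by (rule less_le_trans)
  qed (fact \<epsilon>(2))
qed

section \<open>Calmness with fixed constants\<close>

lemma opt_val_eq_Argmin:
  assumes "xb \<in> Argmin F C \<theta> p"
  shows "opt_val F C \<theta> p = ereal (\<theta> p xb)"
  using assms by (auto simp: Argmin_def opt_val_def intro!: antisym INF_lower)

text \<open>If the parameter moves by \<open>r\<close>, the error bound moves a point by at most
  \<open>l * r / c\<close>, so \<open>\<theta>\<close> changes by at most \<open>L\<close> times the
  larger of the two. Admissible constants stand in for the infima, which need not be
  attained.\<close>

lemma calm_rank_opt_val: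
  fixes C :: "'y::metric_space set"
    and F :: "'p::metric_space \<Rightarrow> 'x::metric_space \<Rightarrow> 'y set"
    and \<theta> :: "'p \<Rightarrow> 'x \<Rightarrow> real"
  assumes C: "C \<noteq> {}" "closed C"
    and F_ne: "\<And>p x. F p x \<noteq> {}"
    and xb: "xb \<in> Argmin F C \<theta> pb"
    and compl: "complete (UNIV :: 'x set)"
    and lsc: "\<exists>\<delta>>0. \<forall>p\<in>cball pb \<delta>. \<forall>x. lsc_at (F p) x"
    and l: "l > 0" and lip_F: "\<exists>\<delta>>0. lip_p_rank F pb l \<delta>"
    and L: "L > 0" "lip_rank \<theta> L"
    and c: "c > 0" "ereal c < strict_outer_partial_slope (merit F C) pb xb"
      "ereal c < slope_outside F C pb"
  shows "\<exists>\<delta>>0. calm_rank (opt_val F C \<theta>) pb (L * max 1 (l / c)) \<delta>"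
proof -
  obtain \<delta>1 where \<delta>1: "\<delta>1 > 0" "\<And>p x. p \<in> cball pb \<delta>1 \<Longrightarrow> lsc_at (F p) x"
    using lsc by blast
  obtain \<delta>2 where \<delta>2: "\<delta>2 > 0" "lip_p_rank F pb l \<delta>2"
    using lip_F by blast
  have feas: "xb \<in> feasible F C pb"
    using xb by (simp add: Argmin_def)
  note zero = merit_eq_0_iff[of C F, OF C(2,1) F_ne]
  have bound: thesis
    if "p \<in> cball pb \<delta>1" "merit F C p x0 \<le> ereal t"
      "\<And>x. dist x x0 \<le> t / c \<Longrightarrow> 0 < merit F C p x \<Longrightarrow> merit F C p x \<le> ereal t \<Longrightarrow>
        ereal c < strong_slope (merit F C p) x"
      "\<And>u. u \<in> feasible F C p \<Longrightarrow> dist u x0 \<le> t / c \<Longrightarrow> thesis"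
    for p x0 t thesis
  proof (rule error_bound[OF compl _ _ that(2) c(1) that(3)])
    show "0 \<le> merit F C p x" for x
      by (intro merit_nonneg F_ne)
    show "\<forall>\<^sub>F z in nhds x. a < merit F C p z" if "a < merit F C p x" for x a
      using \<delta>1(2)[OF \<open>p \<in> cball pb \<delta>1\<close>] that by (rule merit_lsc)
    show thesis if "merit F C p u = 0" "dist u x0 \<le> t / c" for u
      using that \<open>\<And>u. u \<in> feasible F C p \<Longrightarrow> dist u x0 \<le> t / c \<Longrightarrow> thesis\<close> zero by blast
  qed
  obtain \<epsilon> where \<epsilon>: "\<epsilon> > 0"
    "\<And>p x. p \<in> cball pb \<epsilon> \<Longrightarrow> x \<in> cball xb \<epsilon> \<Longrightarrow> 0 < merit F C p x \<Longrightarrow>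
      merit F C p x < ereal \<epsilon> \<Longrightarrow> ereal c < strong_slope (merit F C p) x"
    using strict_outer_partial_slope_gt[OF c(2)] feas zero by (metis add_0)
  \<comment> \<open>The first three radii give lower semicontinuity, the Lipschitz estimate and
    parameters within \<open>\<epsilon>\<close>. The factor 2 makes the merit level
    \<open>l * r\<close> strictly smaller than \<open>\<epsilon>\<close>, and the last radius keeps
    the ball of radius \<open>l * r / c\<close> around \<open>xb\<close> inside
    \<open>cball xb \<epsilon>\<close>.\<close>
  define \<delta> where "\<delta> = Min {\<delta>1, \<delta>2, \<epsilon>, \<epsilon> / (2 * l), c * \<epsilon> / l}"
  have "\<delta> > 0"
    using \<delta>1(1) \<delta>2(1) \<epsilon>(1) l c(1) by (simp add: \<delta>_def)
  have \<theta>_le: "\<theta> p1 x1 \<le> \<theta> p2 x2 + L * max 1 (l / c) * r"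
    if "dist p1 p2 \<le> r" "dist x1 x2 \<le> l * r / c" for p1 p2 x1 x2 r
  proof -
    have "r \<ge> 0"
      using that(1) by (meson order_trans zero_le_dist)
    then have "max (dist p1 p2) (dist x1 x2) \<le> max 1 (l / c) * r"
      using max.mono[OF that] by (simp add: max_mult_distrib_right)
    then have "L * max (dist p1 p2) (dist x1 x2) \<le> L * (max 1 (l / c) * r)"
      using L(1) by simp
    moreover have "\<bar>\<theta> p1 x1 - \<theta> p2 x2\<bar> \<le> L * max (dist p1 p2) (dist x1 x2)"
      using L(2) by (simp add: lip_rank_def)
    ultimately show ?thesis
      by (simp add: mult.assoc)
  qed
  have "\<bar>opt_val F C \<theta> p - opt_val F C \<theta> pb\<bar> \<le> ereal (L * max 1 (l / c) * dist p pb)"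
    if "p \<in> cball pb \<delta>" for p
  proof -
    define r where "r = dist p pb"
    have r_le: "r \<le> \<delta>1" "r \<le> \<delta>2" "r \<le> \<epsilon>" "r \<le> \<epsilon> / (2 * l)" "r \<le> c * \<epsilon> / l"
      using that by (auto simp: \<delta>_def r_def dist_commute)
    have r: "l * r < \<epsilon>" "l * r / c \<le> \<epsilon>"
      using r_le(4,5) l c(1) \<epsilon>(1) by (simp_all add: field_simps)
    have p: "p \<in> cball pb \<delta>1" "p \<in> cball pb \<delta>2" "p \<in> cball pb \<epsilon>" "pb \<in> cball pb \<delta>2" "pb \<in> cball pb \<delta>1"
      using r_le \<delta>1(1) \<delta>2(1) by (auto simp: r_def dist_commute)
    have upper: "opt_val F C \<theta> p \<le> ereal (\<theta> pb xb + L * max 1 (l / c) * r)"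
    proof -
      have "merit F C p xb \<le> ereal (l * r)"
        using merit_le_lip_p_rank[OF \<delta>2(2) p(4,2) F_ne feas] by (simp add: r_def dist_commute)
      then obtain x where x: "x \<in> feasible F C p" "dist x xb \<le> l * r / c"
      proof (rule bound[OF p(1)])
        fix x
        assume "dist x xb \<le> l * r / c" "0 < merit F C p x" "merit F C p x \<le> ereal (l * r)"
        moreover from this have "merit F C p x < ereal \<epsilon>"
          using r(1) by (meson ereal_less(2) le_less_trans less_ereal.simps(1))
        ultimately show "ereal c < strong_slope (merit F C p) x"
          using r(2) p(3) by (intro \<epsilon>(2)) (auto simp: dist_commute)
      qed
      then have "opt_val F C \<theta> p \<le> ereal (\<theta> p x)"
        unfolding opt_val_def by (intro INF_lower)
      also have "\<theta> p x \<le> \<theta> pb xb + L * max 1 (l / c) * r"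
        using x(2) by (intro \<theta>_le) (auto simp: r_def)
      finally show ?thesis
        by simp
    qed
    \<comment> \<open>The point \<open>x\<close> may be far from \<open>xb\<close>, so here the
      slope bound has to come from \<open>slope_outside\<close>, which is global in the space but
      refers to \<open>pb\<close> alone.\<close>
    have lower: "ereal (\<theta> pb xb - L * max 1 (l / c) * r) \<le> opt_val F C \<theta> p"
      unfolding opt_val_def
    proof (rule INF_greatest)
      fix x assume x: "x \<in> feasible F C p"
      have "merit F C pb x \<le> ereal (l * r)"
        using merit_le_lip_p_rank[OF \<delta>2(2) p(2,4) F_ne x] by (simp add: r_def)
      then obtain x' where x': "x' \<in> feasible F C pb" "dist x' x \<le> l * r / c"
      proof (rule bound[OF p(5)])
        fix z
        assume z: "0 < merit F C pb z" "merit F C pb z \<le> ereal (l * r)"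
        then have "z \<notin> feasible F C pb" "merit F C pb z < \<infinity>"
          using zero[of pb z] by auto
        then have "slope_outside F C pb \<le> strong_slope (merit F C pb) z"
          unfolding slope_outside_def by (intro INF_lower) simp
        with c(3) show "ereal c < strong_slope (merit F C pb) z"
          by (rule less_le_trans)
      qed
      then have "ereal (\<theta> pb xb) \<le> ereal (\<theta> pb x')"
        unfolding opt_val_eq_Argmin[OF xb, symmetric] opt_val_def by (intro INF_lower)
      moreover have "\<theta> pb x' \<le> \<theta> p x + L * max 1 (l / c) * r"
        using x'(2) by (intro \<theta>_le) (auto simp: r_def dist_commute)
      ultimately show "ereal (\<theta> pb xb - L * max 1 (l / c) * r) \<le> ereal (\<theta> p x)"
        by simp
    qed
    \<comment> \<open>The two estimates also force the value at \<open>p\<close> to be finite, so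
      the difference is one of real numbers.\<close>
    show ?thesis
      using upper lower unfolding opt_val_eq_Argmin[OF xb] r_def
      by (cases "opt_val F C \<theta> p") auto
  qed
  with \<open>\<delta> > 0\<close> show ?thesis
    unfolding calm_rank_def by blast
qed

section \<open>Passage to the infima\<close>

text \<open>Makes \<open>Lip\<close> and \<open>Lip_p\<close> nonnegative reals that can be
  approached by admissible constants.\<close>

lemma Inf_ereal_image_pos:
  assumes "l \<in> A" "\<And>l. l \<in> A \<Longrightarrow> l > 0"
  obtains r where "Inf (ereal ` A) = ereal r" "r \<ge> 0"
    "\<And>b. r < b \<Longrightarrow> \<exists>l\<in>A. l < b"
proof -
  have "0 \<le> Inf (ereal ` A)"
    by (intro INF_greatest) (auto dest: assms(2))
  moreover have "Inf (ereal ` A) \<le> ereal l"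
    using assms(1) by (auto intro: INF_lower)
  ultimately obtain r where r: "Inf (ereal ` A) = ereal r" "r \<ge> 0"
    by (cases "Inf (ereal ` A)") auto
  moreover have "\<exists>l\<in>A. l < b" if "r < b" for b
    using that less_ereal.simps(1)[of r b] unfolding r(1)[symmetric] INF_less_iff by simp
  ultimately show thesis
    using that by blast
qed

theorem theorem4p3:
  fixes C :: "'y::metric_space set"
    and F :: "'p::metric_space \<Rightarrow> 'x::metric_space \<Rightarrow> 'y set"
    and \<theta> :: "'p \<Rightarrow> 'x \<Rightarrow> real"
    and pb :: 'p and xb :: 'x
  assumes C: "C \<noteq> {}" "closed C" "C \<noteq> UNIV"
    and F_ne: "\<And>p x. F p x \<noteq> {}"
    and xb: "xb \<in> Argmin F C \<theta> pb"
    and i: "complete (UNIV :: 'x set)"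
    and ii: "locally_lipschitz_p F pb"
    and iii: "\<exists>\<delta>>0. \<forall>p\<in>cball pb \<delta>. \<forall>x. lsc_at (F p) x"
    and iv: "min (strict_outer_partial_slope (merit F C) pb xb) (slope_outside F C pb) > 0"
    and v: "lipschitz_fun \<theta>"
  shows "calm_at (opt_val F C \<theta>) pb \<and>
    clm (opt_val F C \<theta>) pb \<le>
      Lip \<theta> * max 1 (Lip_p F pb /
        min (strict_outer_partial_slope (merit F C) pb xb) (slope_outside F C pb))"
proof -
  let ?val = "opt_val F C \<theta>"
  let ?A = "{l. l > 0 \<and> (\<exists>\<delta>>0. lip_p_rank F pb l \<delta>)}"
  let ?B = "{l. l > 0 \<and> lip_rank \<theta> l}"
  define m where "m = min (strict_outer_partial_slope (merit F C) pb xb) (slope_outside F C pb)"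
  obtain l0 where "l0 \<in> ?A"
    using ii by (auto simp: locally_lipschitz_p_def)
  then obtain R where R: "Lip_p F pb = ereal R" "R \<ge> 0" "\<And>b. R < b \<Longrightarrow> \<exists>l\<in>?A. l < b"
    unfolding Lip_p_def by (rule Inf_ereal_image_pos) auto
  obtain L0 where "L0 \<in> ?B"
    using v by (auto simp: lipschitz_fun_def)
  then obtain T where T: "Lip \<theta> = ereal T" "T \<ge> 0" "\<And>b. T < b \<Longrightarrow> \<exists>L\<in>?B. L < b"
    unfolding Lip_def by (rule Inf_ereal_image_pos) auto
  have rank: "\<exists>\<delta>>0. calm_rank ?val pb (L * max 1 (l / c)) \<delta>"
    if "L \<in> ?B" "l \<in> ?A" "c > 0" "ereal c < m" for L l c
    using that C(1,2) F_ne xb i iii by (intro calm_rank_opt_val) (auto simp: m_def)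
  \<comment> \<open>Positivity of \<open>m\<close> excludes a zero denominator; for infinite
    \<open>m\<close> the quotient is 0.\<close>
  have "ereal R / m < \<infinity>"
    using iv unfolding m_def[symmetric] by (cases m) auto
  then have "1 \<le> max 1 (ereal R / m)" "max 1 (ereal R / m) < \<infinity>"
    by (simp_all add: max_def)
  then obtain K where K: "max 1 (ereal R / m) = ereal K" "K \<ge> 1"
    by (cases "max 1 (ereal R / m)") auto
  have ex: "\<exists>L\<in>?B. \<exists>l\<in>?A. \<exists>c>0. ereal c < m \<and> L < t \<and> max 1 (l / c) \<le> a"
    if t: "T < t" and a: "K < a" for t a
  proof -
    have "ereal R / m < ereal a"
      using K(1) a by (metis less_ereal.simps(1) max.cobounded2 le_less_trans)
    then have "ereal (R / a) < m"
      using iv a K(2) R(2) unfolding m_def[symmetric]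
      by (cases m) (auto simp: field_simps)
    \<comment> \<open>With \<open>c\<close> between \<open>R / a\<close> and \<open>m\<close>, some
      admissible \<open>l\<close> lies below \<open>a * c\<close>, so \<open>l / c < a\<close>; the
      entry 1 of the maximum is below \<open>a\<close> since \<open>K \<ge> 1\<close>.\<close>
    then obtain c where c: "R / a < c" "ereal c < m"
      using ereal_dense2 by force
    have "R < a * c"
      using c(1) a K(2) by (simp add: field_simps)
    have "0 \<le> R / a"
      using a K(2) R(2) by simp
    then have "c > 0"
      using c(1) by (rule le_less_trans)
    moreover obtain l where "l \<in> ?A" "l < a * c"
      using R(3)[OF \<open>R < a * c\<close>] by blast
    moreover obtain L where "L \<in> ?B" "L < t"
      using T(3)[OF t] by blast
    ultimately show ?thesis
      using c(2) a K(2) by (intro bexI[of _ L] bexI[of _ l] exI[of _ c]) (auto simp: field_simps)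
  qed
  have "calm_at ?val pb"
  proof -
    obtain L l c where *: "L \<in> ?B" "l \<in> ?A" "c > 0" "ereal c < m"
      using ex[of "T + 1" "K + 1"] by auto
    then have "L * max 1 (l / c) > 0"
      by (intro mult_pos_pos) auto
    with rank[OF *] have "\<exists>l>0. \<exists>\<delta>>0. calm_rank ?val pb l \<delta>"
      by blast
    then show ?thesis
      by (simp add: calm_at_def opt_val_eq_Argmin[OF xb])
  qed
  moreover have "clm ?val pb \<le> ereal T * ereal K"
  proof -
    have bound: "clm ?val pb \<le> ereal (t * a)" if ta: "T < t" "K < a" for t a
    proof -
      obtain L l c where *: "L \<in> ?B" "l \<in> ?A" "c > 0" "ereal c < m" "L < t" "max 1 (l / c) \<le> a"
        using ex[OF ta] by auto
      then have "clm ?val pb \<le> ereal (L * max 1 (l / c))"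
        unfolding clm_def using rank[OF *(1-4)]
        by (intro INF_lower) (auto intro!: mult_pos_pos)
      also have "\<dots> \<le> ereal (t * a)"
        using * T(2) K(2) ta by (auto intro!: mult_mono)
      finally show ?thesis .
    qed
    \<comment> \<open>The bound is available only strictly above \<open>T\<close> and
      \<open>K\<close>, so the product is reached as a limit from the right.\<close>
    have "((\<lambda>e. ereal ((T + e) * (K + e))) \<longlongrightarrow> ereal ((T + 0) * (K + 0))) (at_right 0)"
      by (intro tendsto_intros)
    moreover have "\<forall>\<^sub>F e in at_right 0. clm ?val pb \<le> ereal ((T + e) * (K + e))"
      using eventually_at_right_less by eventually_elim (auto intro: bound)
    ultimately show ?thesis
      by (intro tendsto_lowerbound) auto
  qed
  ultimately show ?thesis
    using K(1) unfolding R(1) T(1) m_def by simp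
qed

end
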